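(* Let $Z$ be a set of partitions, no two of which are comparable under the subpartition relation, and suppose $Z$ contains infinitely many pairwise independent partitions. Let $F_Z$ be the partition ideal with basis $Z$ and let $k$ be any positive integer. Then there is a constant $K=K(k,Z)$ such that $$ p(n,F_Z)<K\,e^{C\sqrt{n}}\,n^{-k} $$ for all sufficiently large $n$, where $C=\pi\sqrt{2/3}$.
   Context: A partition of $n$ is a non-increasing sequence of positive integers (parts) summing to $n$. A partition $\lambda$ is a subpartition of $\gamma$ if no part occurs more times in $\lambda$ than in $\gamma$. A set $X$ of partitions is a partition ideal if whenever $\gamma\in X$ and $\lambda$ is a subpartition of $\gamma$, then $\lambda\in X$. For a set $Z$ of pairwise incomparable partitions, $F_Z$ is the set of all partitions that contain no element of $Z$ as a subpartition; $Z$ is called a basis of $F_Z$. $p(n,X)$ is the number of partitions of $n$ lying in $X$. Two partitions are independent if their parts are pairwise distinct (no part value appears in both). *)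

theory Defs
  imports Complex_Main "HOL-Library.Multiset"
begin

text \<open>A partition is encoded by its multiset of parts, so that the order of the parts is immaterial;
  \<open>count \<gamma> i\<close> is the number of times the part \<open>i\<close> occurs in \<open>\<gamma>\<close>, and the subpartition relation is
  multiset inclusion \<open>\<mu> \<subseteq># \<gamma>\<close>, that is, \<open>count \<mu> i \<le> count \<gamma> i\<close> for all \<open>i\<close>.
  The empty multiset is the unique partition of \<open>0\<close>.\<close>

definition is_partition :: "nat multiset \<Rightarrow> bool" where
  "is_partition \<gamma> \<longleftrightarrow> (\<forall>i \<in># \<gamma>. i > 0)"

definition is_partition_of :: "nat \<Rightarrow> nat multiset \<Rightarrow> bool" where
  "is_partition_of n \<gamma> \<longleftrightarrow> is_partition \<gamma> \<and> sum_mset \<gamma> = n"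

definition incomparable :: "nat multiset \<Rightarrow> nat multiset \<Rightarrow> bool" where
  "incomparable \<mu> \<gamma> \<longleftrightarrow> \<not> \<mu> \<subseteq># \<gamma> \<and> \<not> \<gamma> \<subseteq># \<mu>"

definition independent_partitions :: "nat multiset \<Rightarrow> nat multiset \<Rightarrow> bool" where
  "independent_partitions \<mu> \<gamma> \<longleftrightarrow> set_mset \<mu> \<inter> set_mset \<gamma> = {}"

definition partition_ideal :: "nat multiset set \<Rightarrow> bool" where
  "partition_ideal X \<longleftrightarrow>
     (\<forall>\<gamma>\<in>X. is_partition \<gamma>) \<and>
     (\<forall>\<gamma>\<in>X. \<forall>\<mu>. is_partition \<mu> \<longrightarrow> \<mu> \<subseteq># \<gamma> \<longrightarrow> \<mu> \<in> X)"

definition ideal_with_basis :: "nat multiset set \<Rightarrow> nat multiset set" where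
  "ideal_with_basis Z = {\<gamma>. is_partition \<gamma> \<and> \<not> (\<exists>\<mu>\<in>Z. \<mu> \<subseteq># \<gamma>)}"

definition num_partitions_in :: "nat \<Rightarrow> nat multiset set \<Rightarrow> nat" where
  "num_partitions_in n X = card {\<gamma> \<in> X. is_partition_of n \<gamma>}"

lemma partition_ideal_ideal_with_basis: "partition_ideal (ideal_with_basis Z)"
  unfolding partition_ideal_def ideal_with_basis_def
  using subset_mset.order_trans by blast

text \<open>The cardinality in \<open>num_partitions_in\<close> is that of a finite set.\<close>

lemma finite_partitions_of: "finite {\<gamma>. is_partition_of n \<gamma>}"
proof (rule finite_subset)
  show "{\<gamma>. is_partition_of n \<gamma>} \<subseteq> (\<Union>m\<le>n. multisets_of_size {..n} m)"
  proof safe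
    fix \<gamma> assume "is_partition_of n \<gamma>"
    then have pos: "\<forall>i \<in># \<gamma>. i > 0" and s: "sum_mset \<gamma> = n"
      by (auto simp: is_partition_of_def is_partition_def)
    have "size \<gamma> \<le> sum_mset \<gamma>"
      using pos by (induction \<gamma>) auto
    moreover have "set_mset \<gamma> \<subseteq> {..n}"
      using s by (auto dest: multi_member_split)
    ultimately show "\<gamma> \<in> (\<Union>m\<le>n. multisets_of_size {..n} m)"
      using s by (auto simp: multisets_of_size_def)
  qed
  show "finite (\<Union>m\<le>n. multisets_of_size {..n} m :: nat multiset set)"
    by (intro finite_UN_I finite_multisets_of_size) auto
qed

end

theory Submission
  imports Defs "HOL-Analysis.Gamma_Function"
begin

text \<open>Choose \<open>2k\<close> pairwise independent elements \<open>\<gamma>\<close> of \<open>Z\<close>. Adding \<open>\<gamma>\<close> to a partition does not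
  affect whether it contains one of the others, so the partitions avoiding all of them have the
  generating function \<open>P(q) \<Prod>(1 - q\<^bsup>|\<gamma>|\<^esup>)\<close>, where \<open>P\<close> is the generating function of all partitions.
  Its coefficients are nonnegative, so each of them is at most \<open>q\<^bsup>-n\<^esup>\<close> times its value at \<open>q\<close>. With
  \<open>q = e\<^bsup>-t\<^esup>\<close> one has \<open>P(q) \<le> e\<^bsup>\<pi>\<^sup>2/(6t)\<^esup>\<close> and \<open>1 - q\<^bsup>s\<^esup> \<le> s t\<close>; the choice \<open>t = \<pi>/\<surd>(6n)\<close>
  gives a bound of order \<open>e\<^bsup>C\<surd>n\<^esup> t\<^bsup>2k\<^esup>\<close>.\<close>

section \<open>Counting partitions by removing a fixed one\<close>

lemma num_partitions_in_mono:
  assumes "{\<mu>\<in>X. is_partition_of n \<mu>} \<subseteq> Y"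
  shows "num_partitions_in n X \<le> num_partitions_in n Y"
  unfolding num_partitions_in_def
  by (rule card_mono) (use assms finite_partitions_of[of n] in auto)

text \<open>Removing one copy of \<gamma> is a bijection from the partitions of n in
  \<open>X\<close> that contain \<gamma> onto the partitions of n - |\<gamma>| in \<open>X\<close>.
  Applied to a single part, this builds up the generating function of all partitions; applied to an
  element of the basis, it sieves. The \<open>if\<close> is there because subtraction on
  \<open>nat\<close> is truncated.\<close>

lemma num_partitions_in_split:
  assumes "is_partition \<gamma>" and closed: "\<And>\<mu>. \<gamma> + \<mu> \<in> X \<longleftrightarrow> \<mu> \<in> X"
  shows "num_partitions_in n X = num_partitions_in n {\<mu>\<in>X. \<not> \<gamma> \<subseteq># \<mu>}
    + (if sum_mset \<gamma> \<le> n then num_partitions_in (n - sum_mset \<gamma>) X else 0)"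
proof -
  have fin: "finite {\<mu>\<in>A. is_partition_of m \<mu>}" for A m
    using finite_partitions_of[of m] by (rule rev_finite_subset) auto
  have "{\<mu>\<in>X. is_partition_of n \<mu>} = {\<mu>\<in>{\<mu>\<in>X. \<not> \<gamma> \<subseteq># \<mu>}. is_partition_of n \<mu>}
      \<union> {\<mu>\<in>{\<mu>\<in>X. \<gamma> \<subseteq># \<mu>}. is_partition_of n \<mu>}" by auto
  then have 1: "num_partitions_in n X = num_partitions_in n {\<mu>\<in>X. \<not> \<gamma> \<subseteq># \<mu>}
      + num_partitions_in n {\<mu>\<in>X. \<gamma> \<subseteq># \<mu>}"
    unfolding num_partitions_in_def by (simp only:) (rule card_Un_disjoint[OF fin fin], blast)
  have "num_partitions_in n {\<mu>\<in>X. \<gamma> \<subseteq># \<mu>}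
      = (if sum_mset \<gamma> \<le> n then num_partitions_in (n - sum_mset \<gamma>) X else 0)"
  proof (cases "sum_mset \<gamma> \<le> n")
    case True
    have "{\<mu>\<in>{\<mu>\<in>X. \<gamma> \<subseteq># \<mu>}. is_partition_of n \<mu>}
        = (+) \<gamma> ` {\<mu>\<in>X. is_partition_of (n - sum_mset \<gamma>) \<mu>}"
    proof (intro equalityI subsetI)
      fix \<mu> assume \<mu>: "\<mu> \<in> {\<mu>\<in>{\<mu>\<in>X. \<gamma> \<subseteq># \<mu>}. is_partition_of n \<mu>}"
      then obtain \<nu> where "\<mu> = \<gamma> + \<nu>" by (auto simp: subset_mset.le_iff_add)
      with \<mu> closed show "\<mu> \<in> (+) \<gamma> ` {\<mu>\<in>X. is_partition_of (n - sum_mset \<gamma>) \<mu>}"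
        by (auto simp: is_partition_of_def is_partition_def)
    qed (use True assms in \<open>auto simp: is_partition_of_def is_partition_def\<close>)
    then show ?thesis
      using True by (simp add: num_partitions_in_def card_image)
  next
    case False
    then have "{\<mu>\<in>{\<mu>\<in>X. \<gamma> \<subseteq># \<mu>}. is_partition_of n \<mu>} = {}"
      by (auto simp: is_partition_of_def subset_mset.le_iff_add)
    with False show ?thesis unfolding num_partitions_in_def by (simp only:) simp
  qed
  with 1 show ?thesis by simp
qed

text \<open>Stated for partial sums, so that it serves both an inequality obtained before
  convergence is known and, later, a passage to the limit.\<close>

lemma sum_shift_powers:
  fixes f :: "nat \<Rightarrow> nat" and q :: real
  shows "(\<Sum>n<N. (if s \<le> n then real (f (n - s)) else 0) * q ^ n)
    = q ^ s * (\<Sum>n<N - s. real (f n) * q ^ n)"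
proof -
  have "(\<Sum>n<N. (if s \<le> n then real (f (n - s)) else 0) * q ^ n)
      = (\<Sum>n\<in>{s..<N}. real (f (n - s)) * q ^ n)"
    by (rule sum.mono_neutral_cong_right) auto
  also have "\<dots> = (\<Sum>n<N - s. q ^ s * (real (f n) * q ^ n))"
    by (rule sum.reindex_bij_witness[of _ "\<lambda>n. n + s" "\<lambda>n. n - s"])
       (auto simp flip: power_add)
  finally show ?thesis by (simp add: sum_distrib_left)
qed

section \<open>The generating function of all partitions\<close>

lemma sum_partitions_with_parts_le:
  fixes q :: real
  assumes "finite S" "0 \<notin> S" "0 < q" "q < 1"
  shows "(\<Sum>n<N. real (num_partitions_in n {\<mu>. set_mset \<mu> \<subseteq> S}) * q ^ n)
    \<le> (\<Prod>j\<in>S. 1 / (1 - q ^ j))"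
  using assms(1,2)
proof (induction S)
  case empty
  have "num_partitions_in n {\<mu>. set_mset \<mu> \<subseteq> {}} = (if n = 0 then 1 else 0)" for n
  proof -
    have "{\<mu> \<in> {\<mu>. set_mset \<mu> \<subseteq> {}}. is_partition_of n \<mu>} = (if n = 0 then {{#}} else {})"
      by (auto simp: is_partition_of_def is_partition_def)
    then show ?thesis by (simp add: num_partitions_in_def)
  qed
  then have "(\<Sum>n<N. real (num_partitions_in n {\<mu>. set_mset \<mu> \<subseteq> {}}) * q ^ n)
      = (\<Sum>n<N. if n = 0 then 1 else 0)" by (intro sum.cong) auto
  also have "\<dots> \<le> 1" by (simp add: sum.delta)
  finally show ?case by simp
next
  case (insert j S)
  let ?X = "{\<mu>. set_mset \<mu> \<subseteq> insert j S}" and ?Y = "{\<mu>. set_mset \<mu> \<subseteq> S}"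
  define T where "T M = (\<Sum>n<M. real (num_partitions_in n ?X) * q ^ n)" for M
  have "j > 0" using insert by (cases j) auto
  then have q: "0 < q ^ j" "q ^ j < 1" using assms by (auto simp: power_less_one_iff)
  have eq: "{\<mu>\<in>?X. \<not> {#j#} \<subseteq># \<mu>} = ?Y" using insert.hyps by auto
  have "num_partitions_in n ?X = num_partitions_in n ?Y
      + (if j \<le> n then num_partitions_in (n - j) ?X else 0)" for n
    using num_partitions_in_split[of "{#j#}" ?X n] \<open>j > 0\<close> unfolding eq
    by (simp add: is_partition_def)
  then have "T N = (\<Sum>n<N. real (num_partitions_in n ?Y) * q ^ n
      + (if j \<le> n then real (num_partitions_in (n - j) ?X) else 0) * q ^ n)"
    unfolding T_def by (intro sum.cong) (auto simp: algebra_simps)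
  also have "\<dots> = (\<Sum>n<N. real (num_partitions_in n ?Y) * q ^ n) + q ^ j * T (N - j)"
    unfolding T_def sum.distrib sum_shift_powers[where f = "\<lambda>n. num_partitions_in n ?X"] ..
  \<comment> \<open>The terms are nonnegative, so \<open>N - j\<close> may be enlarged to
    \<open>N\<close>. The inequality then involves \<open>T N\<close> alone and can be solved for
    it, as \<open>q ^ j < 1\<close>.\<close>
  also have "\<dots> \<le> (\<Prod>j\<in>S. 1 / (1 - q ^ j)) + q ^ j * T N"
    using insert q assms unfolding T_def
    by (intro add_mono mult_left_mono sum_mono2) auto
  finally have "T N * (1 - q ^ j) \<le> (\<Prod>j\<in>S. 1 / (1 - q ^ j))" by (simp add: algebra_simps)
  then have "T N \<le> (\<Prod>j\<in>S. 1 / (1 - q ^ j)) / (1 - q ^ j)" using q by (simp add: pos_le_divide_eq)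
  then show ?case using insert.hyps by (simp add: T_def)
qed

text \<open>Sum over \<open>j\<close> the logarithmic series of \<open>-ln (1 - q\<^bsup>j\<^esup>)\<close>: the coefficient of \<open>1/i\<close> is a
  geometric sum, at most \<open>1 / (e\<^bsup>it\<^esup> - 1) \<le> 1/(i t)\<close>.\<close>

lemma prod_inverse_one_minus_exp_le:
  fixes t :: real
  assumes "t > 0"
  shows "(\<Prod>j\<in>{1..N}. 1 / (1 - exp (- t) ^ j)) \<le> exp (pi\<^sup>2 / (6 * t))"
proof -
  define q where "q = exp (- t)"
  have q: "0 < q" "q < 1" using assms by (auto simp: q_def)
  have log_sums: "(\<lambda>i. (q ^ j) ^ Suc i / Suc i) sums - ln (1 - q ^ j)" if "j \<ge> 1" for j
  proof -
    have "norm (q ^ j) < 1" using q that by (simp add: power_less_one_iff abs_of_pos)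
    from ln_series'[of "- (q ^ j)"] this
    have "(\<lambda>i. - ((q ^ j) ^ i) / i) sums ln (1 - q ^ j)" by simp
    from sums_minus[OF this] have "(\<lambda>i. (q ^ j) ^ i / i) sums - ln (1 - q ^ j)" by simp
    \<comment> \<open>The term at index 0 is 1/0 = 0, so the series may start at index 1.\<close>
    then show ?thesis by (subst sums_Suc_iff) simp
  qed
  have sums: "(\<lambda>i. \<Sum>j\<in>{1..N}. (q ^ j) ^ Suc i / Suc i) sums (\<Sum>j\<in>{1..N}. - ln (1 - q ^ j))"
    by (rule sums_sum) (use log_sums in auto)
  have bound: "(\<Sum>j\<in>{1..N}. (q ^ j) ^ Suc i / Suc i) \<le> 1 / t * (1 / (i + 1)\<^sup>2)" for i
  proof -
    define r where "r = q ^ Suc i"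
    have r: "0 < r" "r < 1" using q by (auto simp: r_def power_less_one_iff simp del: power_Suc)
    have rt: "r = exp (- (Suc i * t))" by (simp add: r_def q_def algebra_simps flip: exp_of_nat_mult exp_add)
    have "(\<Sum>j\<in>{1..N}. r ^ j) = r * (\<Sum>j<N. r ^ j)"
      by (simp add: sum_distrib_left sum.atLeast1_atMost_eq)
    also have "\<dots> \<le> r * (1 / (1 - r))"
      using r by (intro mult_left_mono) (simp_all add: sum_gp_strict field_simps)
    also have "\<dots> \<le> 1 / (Suc i * t)"
    proof -
      \<comment> \<open>With x = (i + 1) t and r = e^(-x), the inequality 1 + x \<le> e^x becomes r
        x \<le> 1 - r, that is, r / (1 - r) \<le> 1 / x.\<close>
      have "r * (1 + Suc i * t) \<le> r * exp (Suc i * t)"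
        using r by (intro mult_left_mono) auto
      also have "\<dots> = 1" by (simp add: rt flip: exp_add)
      finally have "r * (Suc i * t) \<le> 1 - r" by (simp only: distrib_left mult_1_right)
      moreover have "Suc i * t > 0" using assms by simp
      ultimately show ?thesis using r by (simp only: mult_1_right times_divide_eq_right)
        (simp add: divide_simps del: of_nat_Suc)
    qed
    finally have "(\<Sum>j\<in>{1..N}. r ^ j) / Suc i \<le> 1 / (Suc i * t) / Suc i"
      by (rule divide_right_mono) simp
    moreover have "(q ^ j) ^ Suc i = r ^ j" for j
      unfolding r_def power_mult[symmetric] by (simp only: mult.commute)
    ultimately show ?thesis
      by (simp add: sum_divide_distrib power2_eq_square field_simps del: power_Suc)
  qed
  have "(\<Sum>j\<in>{1..N}. - ln (1 - q ^ j)) \<le> 1 / t * (pi\<^sup>2 / 6)"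
    by (rule sums_le[OF bound sums], rule sums_mult)
       (use inverse_squares_sums in \<open>simp add: add.commute\<close>)
  moreover have "(\<Prod>j\<in>{1..N}. 1 / (1 - q ^ j)) = exp (\<Sum>j\<in>{1..N}. - ln (1 - q ^ j))"
    unfolding exp_sum[OF finite_atLeastAtMost]
    by (intro prod.cong refl) (use q in \<open>auto simp: exp_minus inverse_eq_divide power_less_one_iff\<close>)
  ultimately show ?thesis by (simp add: q_def mult.commute)
qed

text \<open>With an empty basis nothing is forbidden, so the ideal consists of all partitions. Those
  of n < N have their parts in \<open>{1..N}\<close>, so the finite products bound all partial sums
  uniformly; nonnegativity then gives convergence.\<close>

lemma partitions_generating_function_le:
  fixes t :: real
  assumes "t > 0"
  defines "f \<equiv> \<lambda>n. real (num_partitions_in n (ideal_with_basis {})) * exp (- t) ^ n"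
  shows "summable f" and "suminf f \<le> exp (pi\<^sup>2 / (6 * t))"
proof -
  have nonneg: "f n \<ge> 0" for n by (simp add: f_def)
  have le: "sum f {..<N} \<le> exp (pi\<^sup>2 / (6 * t))" for N
  proof -
    have "num_partitions_in n (ideal_with_basis {})
        \<le> num_partitions_in n {\<mu>. set_mset \<mu> \<subseteq> {1..N}}" if "n < N" for n
      using that by (intro num_partitions_in_mono)
        (fastforce simp: is_partition_of_def is_partition_def dest: multi_member_split)
    then have "sum f {..<N}
        \<le> (\<Sum>n<N. real (num_partitions_in n {\<mu>. set_mset \<mu> \<subseteq> {1..N}}) * exp (- t) ^ n)"
      unfolding f_def by (intro sum_mono mult_right_mono) auto
    also have "\<dots> \<le> (\<Prod>j\<in>{1..N}. 1 / (1 - exp (- t) ^ j))"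
      using assms by (intro sum_partitions_with_parts_le) auto
    also have "\<dots> \<le> exp (pi\<^sup>2 / (6 * t))" by (rule prod_inverse_one_minus_exp_le) fact
    finally show ?thesis .
  qed
  show "summable f" by (rule summableI_nonneg_bounded[OF nonneg le])
  then show "suminf f \<le> exp (pi\<^sup>2 / (6 * t))" by (intro suminf_le_const le)
qed

section \<open>Sieving by pairwise independent partitions\<close>

lemma ideal_with_basis_insert:
  "ideal_with_basis (insert \<gamma> G) = {\<mu>\<in>ideal_with_basis G. \<not> \<gamma> \<subseteq># \<mu>}"
  by (auto simp: ideal_with_basis_def)

text \<open>No part of \<delta> occurs in \<gamma>, so adding \<gamma> leaves the multiplicities of
  the parts of \<delta> unchanged. This is the closure condition of
  \<open>num_partitions_in_split\<close>.\<close>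

lemma ideal_with_basis_add_independent:
  assumes "is_partition \<gamma>" "\<And>\<delta>. \<delta> \<in> G \<Longrightarrow> independent_partitions \<delta> \<gamma>"
  shows "\<gamma> + \<mu> \<in> ideal_with_basis G \<longleftrightarrow> \<mu> \<in> ideal_with_basis G"
proof -
  have "\<delta> \<subseteq># \<gamma> + \<mu> \<longleftrightarrow> \<delta> \<subseteq># \<mu>" if "\<delta> \<in> G" for \<delta>
  proof -
    have "count \<gamma> x = 0" if "count \<delta> x \<noteq> 0" for x
      using that assms(2)[OF \<open>\<delta> \<in> G\<close>] count_eq_zero_iff
      unfolding independent_partitions_def by fastforce
    then show ?thesis unfolding subseteq_mset_def
      by (metis count_union add_0 le0)
  qed
  then show ?thesis using assms(1) by (auto simp: ideal_with_basis_def is_partition_def)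
qed

text \<open>By the splitting, the old series is the new one plus q^|\<gamma>| times the old one, so
  each new \<gamma> contributes a factor 1 - q^|\<gamma>|.\<close>

lemma ideal_generating_function:
  fixes q S :: real
  assumes "finite G" "\<And>\<gamma>. \<gamma> \<in> G \<Longrightarrow> is_partition \<gamma>" "pairwise independent_partitions G"
    and "(\<lambda>n. real (num_partitions_in n (ideal_with_basis {})) * q ^ n) sums S"
  shows "(\<lambda>n. real (num_partitions_in n (ideal_with_basis G)) * q ^ n)
    sums (S * (\<Prod>\<gamma>\<in>G. 1 - q ^ sum_mset \<gamma>))"
  using assms(1-3)
proof (induction G)
  case empty
  then show ?case using assms(4) by simp
next
  case (insert \<gamma> G)
  let ?f = "\<lambda>n. num_partitions_in n (ideal_with_basis G)"
  let ?A = "S * (\<Prod>\<gamma>\<in>G. 1 - q ^ sum_mset \<gamma>)" and ?s = "sum_mset \<gamma>"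
  have IH: "(\<lambda>n. real (?f n) * q ^ n) sums ?A"
    using insert by (auto simp: pairwise_insert)
  have indep: "independent_partitions \<delta> \<gamma>" if "\<delta> \<in> G" for \<delta>
    using that insert by (auto simp: pairwise_insert)
  have split: "?f n = num_partitions_in n (ideal_with_basis (insert \<gamma> G))
      + (if ?s \<le> n then ?f (n - ?s) else 0)" for n
    unfolding ideal_with_basis_insert
    by (intro num_partitions_in_split ideal_with_basis_add_independent indep)
       (use insert in auto)
  have "(\<lambda>N. \<Sum>n<N - ?s. real (?f n) * q ^ n) \<longlonglongrightarrow> ?A"
    using IH unfolding sums_def by (rule filterlim_compose) (rule filterlim_minus_const_nat_at_top)
  then have "(\<lambda>n. (if ?s \<le> n then real (?f (n - ?s)) else 0) * q ^ n) sums (q ^ ?s * ?A)"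
    unfolding sums_def sum_shift_powers[where f = ?f] by (rule tendsto_mult_left)
  moreover have "real (num_partitions_in n (ideal_with_basis (insert \<gamma> G))) * q ^ n
      = real (?f n) * q ^ n - (if ?s \<le> n then real (?f (n - ?s)) else 0) * q ^ n" for n
    using split[of n] by (auto simp: algebra_simps)
  ultimately have "(\<lambda>n. real (num_partitions_in n (ideal_with_basis (insert \<gamma> G))) * q ^ n)
      sums (?A - q ^ ?s * ?A)"
    using sums_diff[OF IH] by simp
  moreover have "?A - q ^ ?s * ?A = S * (\<Prod>\<gamma>\<in>insert \<gamma> G. 1 - q ^ sum_mset \<gamma>)"
    using insert.hyps by (simp add: algebra_simps)
  ultimately show ?case by simp
qed

section \<open>The coefficient bound and the choice of parameters\<close>

lemma num_partitions_avoiding_le: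
  assumes "finite G" "\<And>\<gamma>. \<gamma> \<in> G \<Longrightarrow> is_partition \<gamma>" "pairwise independent_partitions G"
    and "t > 0"
  shows "real (num_partitions_in n (ideal_with_basis G))
    \<le> exp (pi\<^sup>2 / (6 * t) + real n * t) * (t ^ card G * (\<Prod>\<gamma>\<in>G. real (sum_mset \<gamma>)))"
proof -
  define q where "q = exp (- t)"
  have q: "0 < q" "q < 1" using assms by (auto simp: q_def)
  let ?p = "\<lambda>n. real (num_partitions_in n (ideal_with_basis {})) * q ^ n"
  let ?f = "\<lambda>n. real (num_partitions_in n (ideal_with_basis G)) * q ^ n"
  have p: "summable ?p" "suminf ?p \<le> exp (pi\<^sup>2 / (6 * t))"
    using partitions_generating_function_le[OF \<open>t > 0\<close>] by (simp_all add: q_def)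
  have f: "?f sums (suminf ?p * (\<Prod>\<gamma>\<in>G. 1 - q ^ sum_mset \<gamma>))"
    using assms p by (intro ideal_generating_function summable_sums) auto
  have "?f n = sum ?f {n}" by simp
  also have "\<dots> \<le> suminf ?f"
    using q by (intro sum_le_suminf sums_summable[OF f]) auto
  also have "\<dots> = suminf ?p * (\<Prod>\<gamma>\<in>G. 1 - q ^ sum_mset \<gamma>)"
    using f by (simp add: sums_iff)
  \<comment> \<open>Every element of \<open>G\<close> yields one factor t, which is the source of
    the saving.\<close>
  also have "\<dots> \<le> exp (pi\<^sup>2 / (6 * t)) * (\<Prod>\<gamma>\<in>G. t * real (sum_mset \<gamma>))"
  proof (intro mult_mono p prod_mono prod_nonneg conjI)
    fix \<gamma> assume "\<gamma> \<in> G"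
    show nonneg: "0 \<le> 1 - q ^ sum_mset \<gamma>" using q by (simp add: power_le_one)
    have "q ^ sum_mset \<gamma> = exp (- (t * sum_mset \<gamma>))"
      by (simp add: q_def mult.commute flip: exp_of_nat_mult)
    then show "1 - q ^ sum_mset \<gamma> \<le> t * real (sum_mset \<gamma>)"
      using exp_ge_add_one_self[of "- (t * sum_mset \<gamma>)"] by linarith
  qed (use q in \<open>auto intro!: power_le_one\<close>)
  finally have "?f n * exp (real n * t)
      \<le> exp (pi\<^sup>2 / (6 * t)) * (\<Prod>\<gamma>\<in>G. t * real (sum_mset \<gamma>)) * exp (real n * t)"
    by (rule mult_right_mono) simp
  also have "?f n * exp (real n * t) = real (num_partitions_in n (ideal_with_basis G))"
    by (simp add: q_def flip: exp_of_nat_mult exp_add)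
  finally show ?thesis
    unfolding exp_add prod.distrib prod_constant by (simp only: mult_ac)
qed

theorem theorem6:
  fixes Z :: "nat multiset set" and k :: nat
  assumes "\<forall>\<gamma>\<in>Z. is_partition \<gamma>"
    and "pairwise incomparable Z"
    and "\<exists>W\<subseteq>Z. infinite W \<and> pairwise independent_partitions W"
    and "k > 0"
  shows "\<exists>K::real. \<forall>\<^sub>F n in sequentially.
           real (num_partitions_in n (ideal_with_basis Z))
             < K * exp (pi * sqrt (2 / 3) * sqrt (real n)) * real n powi (- int k)"
proof -
  obtain W where W: "W \<subseteq> Z" "infinite W" "pairwise independent_partitions W"
    using assms(3) by blast
  \<comment> \<open>As t will be of order n^(-1/2), a saving of n^(-k) takes 2k factors t.\<close>
  obtain G where G: "finite G" "card G = 2 * k" "G \<subseteq> W"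
    using infinite_arbitrarily_large[OF W(2)] by blast
  define c where "c = (pi\<^sup>2 / 6) ^ k * (\<Prod>\<gamma>\<in>G. real (sum_mset \<gamma>))"
  have "real (num_partitions_in n (ideal_with_basis Z))
      < (c + 1) * exp (pi * sqrt (2 / 3) * sqrt (real n)) * real n powi (- int k)" if "n > 0" for n
  proof -
    let ?E = "exp (pi * sqrt (2 / 3) * sqrt (real n))"
    \<comment> \<open>This t minimizes \<pi>^2/(6t) + nt: both summands equal \<pi> sqrt(n/6), half
      of the desired exponent.\<close>
    define t where "t = pi / sqrt (6 * n)"
    have t: "t > 0" "t\<^sup>2 = pi\<^sup>2 / 6 / n" using that by (auto simp: t_def power_divide)
    have "sqrt (2 / 3) = 2 / sqrt 6"
      by (rule real_sqrt_unique) (auto simp: power_divide)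
    moreover have "pi\<^sup>2 / (6 * t) = n * t"
      using t that by (simp add: power2_eq_square field_simps)
    moreover have "n * t = pi / sqrt 6 * sqrt n"
      using that by (simp add: t_def real_sqrt_mult field_simps)
    ultimately have exponent: "pi\<^sup>2 / (6 * t) + n * t = pi * sqrt (2 / 3) * sqrt n" by simp
    have "t ^ card G = (pi\<^sup>2 / 6) ^ k * real n powi (- int k)"
      unfolding G power_mult t power_divide[of _ "real n"] power_int_minus power_int_of_nat
      by (rule divide_inverse)
    \<comment> \<open>Forbidding only the elements of \<open>G\<close>, a subset of
      \<open>Z\<close>, enlarges the ideal.\<close>
    moreover have "num_partitions_in n (ideal_with_basis Z) \<le> num_partitions_in n (ideal_with_basis G)"
      using G W by (intro num_partitions_in_mono) (auto simp: ideal_with_basis_def)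
    moreover have "real (num_partitions_in n (ideal_with_basis G))
        \<le> exp (pi\<^sup>2 / (6 * t) + n * t) * (t ^ card G * (\<Prod>\<gamma>\<in>G. real (sum_mset \<gamma>)))"
      by (rule num_partitions_avoiding_le)
         (use G W t assms(1) pairwise_subset in blast)+
    ultimately have "real (num_partitions_in n (ideal_with_basis Z)) \<le> c * ?E * real n powi (- int k)"
      unfolding exponent c_def by (simp add: mult_ac)
    \<comment> \<open>Passing from c to c + 1 makes the inequality strict.\<close>
    also have "\<dots> < (c + 1) * ?E * real n powi (- int k)"
      using that by (intro mult_strict_right_mono) auto
    finally show ?thesis .
  qed
  then show ?thesis
    by (intro exI[of _ "c + 1"] eventually_mono[OF eventually_gt_at_top[of 0]])
qed

end
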